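(* Let $K$ be a nonzero commutative, associative and unital ring. Let $\mathcal{F},\mathcal{G}\colon \mathbf{alg}_K\to\mathbf{Alg}_K$ be extension invariant functors and let $\varphi\colon R\to S$ be a homomorphism in $\mathbf{alg}_K$. If $\mathcal{F}(R)\cong\mathcal{G}(R)$ as $R$-algebras, then $\mathcal{F}(S)\cong\mathcal{G}(S)$ as $S$-algebras. In particular, if $R\in\mathbf{alg}_K$ and there is a homomorphism $\psi\colon R\to K$ in $\mathbf{alg}_K$, then $\mathcal{F}(R)\cong\mathcal{G}(R)$ as $R$-algebras implies $\mathcal{F}(K)\cong\mathcal{G}(K)$ as $K$-algebras, and hence $\mathcal{F}(S)\cong\mathcal{G}(S)$ as $S$-algebras for every $S\in\mathbf{alg}_K$.
   Context: $\mathbf{alg}_K$ is the category of associative and commutative $K$-algebras with non-zero unit (morphisms are unital $K$-algebra homomorphisms). $\mathbf{Alg}_K$ is the category of all $K$-algebras, not necessarily associative, commutative or unital. A $K$-algebra functor is a functor $\mathcal{F}\colon\mathbf{alg}_K\to\mathbf{Alg}_K$ such that $\mathcal{F}(R)$ is an $R$-algebra for every $R\in\mathbf{alg}_K$. A $K$-algebra functor $\mathcal{F}$ is extension invariant if for every $R\in\mathbf{alg}_K$ there is an $R$-algebra isomorphism $\tau_R\colon\mathcal{F}(R)\to\mathcal{F}(K)\otimes_K R$ that is natural in $R$, i.e. for every homomorphism $\alpha\colon R\to R'$ in $\mathbf{alg}_K$ one has $(1_{\mathcal{F}(K)}\otimes_K\alpha)\circ\tau_R=\tau_{R'}\circ\mathcal{F}(\alpha)$.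 *)

theory Defs
  imports "HOL-Algebra.Module" "HOL-Algebra.QuotRing" "HOL-Algebra.Free_Abelian_Groups"
begin

section \<open>The two categories of algebras\<close>

text \<open>
  The ring \<open>K\<close> and the objects of \<open>alg\<^sub>K\<close> have carriers in one arbitrary
  type \<open>'r\<close>, which plays the role of the universe.  Homomorphisms are extensional functions, so
  that equality of arrows is equality in HOL.
\<close>

definition alg_obj :: "'r ring \<Rightarrow> ('r, 'r) module \<Rightarrow> bool" where
  "alg_obj K R \<longleftrightarrow> algebra K R \<and> \<one>\<^bsub>R\<^esub> \<noteq> \<zero>\<^bsub>R\<^esub>"

definition alg_hom :: "'r ring \<Rightarrow> ('r, 'r) module \<Rightarrow> ('r, 'r) module \<Rightarrow> ('r \<Rightarrow> 'r) set" where
  "alg_hom K R S =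
     {f \<in> ring_hom R S. f \<in> extensional (carrier R) \<and>
        (\<forall>k\<in>carrier K. \<forall>x\<in>carrier R. f (k \<odot>\<^bsub>R\<^esub> x) = k \<odot>\<^bsub>S\<^esub> f x)}"

definition self_algebra :: "'r ring \<Rightarrow> ('r, 'r) module" where
  "self_algebra K =
     \<lparr>carrier = carrier K, mult = mult K, one = \<one>\<^bsub>K\<^esub>, ring.zero = \<zero>\<^bsub>K\<^esub>, add = add K,
      smult = mult K\<rparr>"

text \<open>
  Algebras that need not be associative, commutative or unital.  The \<open>one\<close> field of the record
  is subject to no condition, and homomorphisms ignore it.
\<close>

locale nonassoc_algebra = module +
  assumes mult_closed:
      "\<lbrakk>x \<in> carrier M; y \<in> carrier M\<rbrakk> \<Longrightarrow> x \<otimes>\<^bsub>M\<^esub> y \<in> carrier M"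
    and mult_l_distr:
      "\<lbrakk>x \<in> carrier M; y \<in> carrier M; z \<in> carrier M\<rbrakk> \<Longrightarrow>
       (x \<oplus>\<^bsub>M\<^esub> y) \<otimes>\<^bsub>M\<^esub> z = x \<otimes>\<^bsub>M\<^esub> z \<oplus>\<^bsub>M\<^esub> y \<otimes>\<^bsub>M\<^esub> z"
    and mult_r_distr:
      "\<lbrakk>x \<in> carrier M; y \<in> carrier M; z \<in> carrier M\<rbrakk> \<Longrightarrow>
       z \<otimes>\<^bsub>M\<^esub> (x \<oplus>\<^bsub>M\<^esub> y) = z \<otimes>\<^bsub>M\<^esub> x \<oplus>\<^bsub>M\<^esub> z \<otimes>\<^bsub>M\<^esub> y"
    and mult_smult_l:
      "\<lbrakk>a \<in> carrier R; x \<in> carrier M; y \<in> carrier M\<rbrakk> \<Longrightarrow>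
       (a \<odot>\<^bsub>M\<^esub> x) \<otimes>\<^bsub>M\<^esub> y = a \<odot>\<^bsub>M\<^esub> (x \<otimes>\<^bsub>M\<^esub> y)"
    and mult_smult_r:
      "\<lbrakk>a \<in> carrier R; x \<in> carrier M; y \<in> carrier M\<rbrakk> \<Longrightarrow>
       x \<otimes>\<^bsub>M\<^esub> (a \<odot>\<^bsub>M\<^esub> y) = a \<odot>\<^bsub>M\<^esub> (x \<otimes>\<^bsub>M\<^esub> y)"

definition nonassoc_hom ::
    "('r, 'm) ring_scheme \<Rightarrow> ('r, 'a) module \<Rightarrow> ('r, 'b) module \<Rightarrow> ('a \<Rightarrow> 'b) set" where
  "nonassoc_hom R A B =
     {f \<in> carrier A \<rightarrow>\<^sub>E carrier B.
        (\<forall>x\<in>carrier A. \<forall>y\<in>carrier A. f (x \<oplus>\<^bsub>A\<^esub> y) = f x \<oplus>\<^bsub>B\<^esub> f y) \<and>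
        (\<forall>x\<in>carrier A. \<forall>y\<in>carrier A. f (x \<otimes>\<^bsub>A\<^esub> y) = f x \<otimes>\<^bsub>B\<^esub> f y) \<and>
        (\<forall>r\<in>carrier R. \<forall>x\<in>carrier A. f (r \<odot>\<^bsub>A\<^esub> x) = r \<odot>\<^bsub>B\<^esub> f x)}"

definition nonassoc_iso ::
    "('r, 'm) ring_scheme \<Rightarrow> ('r, 'a) module \<Rightarrow> ('r, 'b) module \<Rightarrow> ('a \<Rightarrow> 'b) set" where
  "nonassoc_iso R A B = {f \<in> nonassoc_hom R A B. bij_betw f (carrier A) (carrier B)}"

definition nonassoc_isomorphic ::
    "('r, 'm) ring_scheme \<Rightarrow> ('r, 'a) module \<Rightarrow> ('r, 'b) module \<Rightarrow> bool" where
  "nonassoc_isomorphic R A B \<longleftrightarrow> nonassoc_iso R A B \<noteq> {}"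

text \<open>Restriction of scalars along the structure map \<open>k \<mapsto> k \<cdot> 1\<close> of \<open>R\<close>.\<close>

definition restrict_scalars :: "('r, 'r) module \<Rightarrow> ('r, 'a) module \<Rightarrow> ('r, 'a) module" where
  "restrict_scalars R A = A\<lparr>smult := \<lambda>k x. (k \<odot>\<^bsub>R\<^esub> \<one>\<^bsub>R\<^esub>) \<odot>\<^bsub>A\<^esub> x\<rparr>"


section \<open>Extension of scalars\<close>

text \<open>
  \<open>A \<otimes>\<^sub>K R\<close> is the free abelian group on \<open>A \<times> R\<close> modulo the subgroup generated by the
  biadditivity and \<open>K\<close>-balancing relators.  Operations on cosets are defined through all
  representatives, as in \<^const>\<open>rcoset_mult\<close>.
\<close>

definition tensor_free :: "('r, 'a) module \<Rightarrow> ('r, 'r) module \<Rightarrow> ('a \<times> 'r \<Rightarrow>\<^sub>0 int) monoid" where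
  "tensor_free A R = free_Abelian_group (carrier A \<times> carrier R)"

definition tensor_relators ::
    "'r ring \<Rightarrow> ('r, 'a) module \<Rightarrow> ('r, 'r) module \<Rightarrow> ('a \<times> 'r \<Rightarrow>\<^sub>0 int) set" where
  "tensor_relators K A R =
     {frag_of (a \<oplus>\<^bsub>A\<^esub> b, r) - frag_of (a, r) - frag_of (b, r) | a b r.
        a \<in> carrier A \<and> b \<in> carrier A \<and> r \<in> carrier R} \<union>
     {frag_of (a, r \<oplus>\<^bsub>R\<^esub> s) - frag_of (a, r) - frag_of (a, s) | a r s.
        a \<in> carrier A \<and> r \<in> carrier R \<and> s \<in> carrier R} \<union>
     {frag_of (k \<odot>\<^bsub>A\<^esub> a, r) - frag_of (a, k \<odot>\<^bsub>R\<^esub> r) | k a r.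
        k \<in> carrier K \<and> a \<in> carrier A \<and> r \<in> carrier R}"

definition tensor_ker ::
    "'r ring \<Rightarrow> ('r, 'a) module \<Rightarrow> ('r, 'r) module \<Rightarrow> ('a \<times> 'r \<Rightarrow>\<^sub>0 int) set" where
  "tensor_ker K A R = generate (tensor_free A R) (tensor_relators K A R)"

abbreviation tensor_class ::
    "'r ring \<Rightarrow> ('r, 'a) module \<Rightarrow> ('r, 'r) module \<Rightarrow> ('a \<times> 'r \<Rightarrow>\<^sub>0 int) \<Rightarrow>
     ('a \<times> 'r \<Rightarrow>\<^sub>0 int) set" where
  "tensor_class K A R x \<equiv> tensor_ker K A R #>\<^bsub>tensor_free A R\<^esub> x"

text \<open>Biadditive extension of \<open>(a, r) (b, s) = (a b, r s)\<close> to formal sums.\<close>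

definition formal_mult ::
    "('r, 'a) module \<Rightarrow> ('r, 'r) module \<Rightarrow> ('a \<times> 'r \<Rightarrow>\<^sub>0 int) \<Rightarrow> ('a \<times> 'r \<Rightarrow>\<^sub>0 int) \<Rightarrow>
     ('a \<times> 'r \<Rightarrow>\<^sub>0 int)" where
  "formal_mult A R x y =
     frag_extend (\<lambda>(a, r). frag_extend (\<lambda>(b, s). frag_of (a \<otimes>\<^bsub>A\<^esub> b, r \<otimes>\<^bsub>R\<^esub> s)) y) x"

text \<open>The induced \<open>R\<close>-algebra structure, with \<open>t \<cdot> (a \<otimes> r) = a \<otimes> t r\<close>.\<close>

definition tensor_algebra ::
    "'r ring \<Rightarrow> ('r, 'a) module \<Rightarrow> ('r, 'r) module \<Rightarrow> ('r, ('a \<times> 'r \<Rightarrow>\<^sub>0 int) set) module" where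
  "tensor_algebra K A R =
     \<lparr>carrier = carrier (tensor_free A R Mod tensor_ker K A R),
      mult = (\<lambda>X Y. \<Union>x\<in>X. \<Union>y\<in>Y. tensor_class K A R (formal_mult A R x y)),
      one = undefined,
      ring.zero = tensor_ker K A R,
      add = mult (tensor_free A R Mod tensor_ker K A R),
      smult = (\<lambda>t X. \<Union>x\<in>X.
        tensor_class K A R (frag_extend (\<lambda>(a, r). frag_of (a, t \<otimes>\<^bsub>R\<^esub> r)) x))\<rparr>"

text \<open>The map \<open>1 \<otimes> \<alpha> : A \<otimes>\<^sub>K R \<rightarrow> A \<otimes>\<^sub>K S\<close>.\<close>

definition tensor_map ::
    "'r ring \<Rightarrow> ('r, 'a) module \<Rightarrow> ('r, 'r) module \<Rightarrow> ('r \<Rightarrow> 'r) \<Rightarrow>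
     ('a \<times> 'r \<Rightarrow>\<^sub>0 int) set \<Rightarrow> ('a \<times> 'r \<Rightarrow>\<^sub>0 int) set" where
  "tensor_map K A S \<alpha> X =
     (\<Union>x\<in>X. tensor_class K A S (frag_extend (\<lambda>(a, r). frag_of (a, \<alpha> r)) x))"


section \<open>Algebra functors\<close>

text \<open>
  \<open>Fo\<close> is the object map and \<open>Fm R S \<alpha>\<close> the image of the arrow \<open>\<alpha> : R \<rightarrow> S\<close>.  The value
  \<open>Fo R\<close> carries its \<open>R\<close>-algebra structure; the underlying object of \<open>Alg\<^sub>K\<close> is obtained by
  restriction of scalars, and the arrows \<open>Fm R S \<alpha>\<close> are only required to be \<open>K\<close>-linear.
\<close>

locale algebra_functor =
  fixes K :: "'r ring"
    and Fo :: "('r, 'r) module \<Rightarrow> ('r, 'a) module"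
    and Fm :: "('r, 'r) module \<Rightarrow> ('r, 'r) module \<Rightarrow> ('r \<Rightarrow> 'r) \<Rightarrow> 'a \<Rightarrow> 'a"
  assumes obj: "alg_obj K R \<Longrightarrow> nonassoc_algebra R (Fo R)"
    and arr: "\<lbrakk>alg_obj K R; alg_obj K S; \<alpha> \<in> alg_hom K R S\<rbrakk> \<Longrightarrow>
      Fm R S \<alpha> \<in> nonassoc_hom K (restrict_scalars R (Fo R)) (restrict_scalars S (Fo S))"
    and ident: "alg_obj K R \<Longrightarrow>
      Fm R R (restrict id (carrier R)) = restrict id (carrier (Fo R))"
    and comp: "\<lbrakk>alg_obj K R; alg_obj K S; alg_obj K T;
        \<alpha> \<in> alg_hom K R S; \<beta> \<in> alg_hom K S T\<rbrakk> \<Longrightarrow>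
      Fm R T (compose (carrier R) \<beta> \<alpha>) = compose (carrier (Fo R)) (Fm S T \<beta>) (Fm R S \<alpha>)"

definition extension_invariant ::
    "'r ring \<Rightarrow> (('r, 'r) module \<Rightarrow> ('r, 'a) module) \<Rightarrow>
     (('r, 'r) module \<Rightarrow> ('r, 'r) module \<Rightarrow> ('r \<Rightarrow> 'r) \<Rightarrow> 'a \<Rightarrow> 'a) \<Rightarrow> bool" where
  "extension_invariant K Fo Fm \<longleftrightarrow>
     (\<exists>\<tau>. (\<forall>R. alg_obj K R \<longrightarrow>
            \<tau> R \<in> nonassoc_iso R (Fo R) (tensor_algebra K (Fo (self_algebra K)) R)) \<and>
          (\<forall>R S. \<forall>\<alpha>\<in>alg_hom K R S. alg_obj K R \<longrightarrow> alg_obj K S \<longrightarrow>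
            (\<forall>x\<in>carrier (Fo R).
               tensor_map K (Fo (self_algebra K)) S \<alpha> (\<tau> R x) = \<tau> S (Fm R S \<alpha> x))))"

end

theory Submission
  imports Defs
begin

text \<open>
  Write \<open>A = F(K)\<close>, so that \<open>F(R)\<close> is \<open>A \<otimes>\<^sub>K R\<close>.  Extension of scalars is left adjoint to restriction:
  \<open>R\<close>-algebra homomorphisms \<open>A \<otimes>\<^sub>K R \<rightarrow> N\<close> correspond to \<open>K\<close>-algebra homomorphisms \<open>A \<rightarrow> N\<close> by
  restricting along \<open>a \<mapsto> a \<otimes> 1\<close>.  Existence is \<open>nonassoc_hom_lift\<close>; uniqueness, \<open>semilinear_eqI\<close>, is
  proved for semilinear maps because \<open>F(\<phi>)\<close> is linear only along \<open>\<phi>\<close>.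

  Given \<open>\<phi> : R \<rightarrow> S\<close> and an isomorphism \<open>\<theta> : F(R) \<rightarrow> G(R)\<close>, the composite
  \<open>A \<rightarrow> F(R) \<rightarrow> G(R) \<rightarrow> G(S)\<close> of \<open>a \<mapsto> a \<otimes> 1\<close>, \<open>\<theta>\<close> and \<open>G(\<phi>)\<close> extends to an \<open>S\<close>-algebra homomorphism
  \<open>h : F(S) \<rightarrow> G(S)\<close>, and uniqueness upgrades this to \<open>h \<circ> F(\<phi>) = G(\<phi>) \<circ> \<theta>\<close> on all of \<open>F(R)\<close>.
  The same construction for the inverse of \<open>\<theta>\<close> gives \<open>h' : G(S) \<rightarrow> F(S)\<close>.  Then \<open>h' \<circ> h\<close> fixes the image of
  \<open>F(\<phi>)\<close>, which contains all \<open>a \<otimes> 1\<close>, so it is the identity, and likewise \<open>h \<circ> h'\<close>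
  (\<open>isomorphic_change_of_scalars\<close>).  The remaining claims use the arrows \<open>\<psi> : R \<rightarrow> K\<close> and \<open>K \<rightarrow> S\<close>.

  The tensor product enters only through a presentation: a surjection from formal sums onto \<open>F(R)\<close>
  whose kernel is generated by the tensor relations, compatible with multiplication and scalars
  (\<open>scalar_extension\<close>).  Transporting it to \<open>F(R)\<close> avoids verifying the algebra axioms for cosets,
  since \<open>F(R)\<close> is an algebra by hypothesis.
\<close>

section \<open>Homomorphisms\<close>

lemma nonassoc_homD:
  assumes "f \<in> nonassoc_hom R A B"
  shows "f \<in> extensional (carrier A)"
    and "x \<in> carrier A \<Longrightarrow> f x \<in> carrier B"
    and "\<lbrakk>x \<in> carrier A; y \<in> carrier A\<rbrakk> \<Longrightarrow> f (x \<oplus>\<^bsub>A\<^esub> y) = f x \<oplus>\<^bsub>B\<^esub> f y"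
    and "\<lbrakk>x \<in> carrier A; y \<in> carrier A\<rbrakk> \<Longrightarrow> f (x \<otimes>\<^bsub>A\<^esub> y) = f x \<otimes>\<^bsub>B\<^esub> f y"
    and "\<lbrakk>r \<in> carrier R; x \<in> carrier A\<rbrakk> \<Longrightarrow> f (r \<odot>\<^bsub>A\<^esub> x) = r \<odot>\<^bsub>B\<^esub> f x"
  using assms by (auto simp: nonassoc_hom_def PiE_iff)

lemma restrict_in_nonassoc_hom:
  assumes "nonassoc_algebra R A"
    and "\<And>x. x \<in> carrier A \<Longrightarrow> f x \<in> carrier B"
    and "\<And>x y. \<lbrakk>x \<in> carrier A; y \<in> carrier A\<rbrakk> \<Longrightarrow> f (x \<oplus>\<^bsub>A\<^esub> y) = f x \<oplus>\<^bsub>B\<^esub> f y"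
    and "\<And>x y. \<lbrakk>x \<in> carrier A; y \<in> carrier A\<rbrakk> \<Longrightarrow> f (x \<otimes>\<^bsub>A\<^esub> y) = f x \<otimes>\<^bsub>B\<^esub> f y"
    and "\<And>r x. \<lbrakk>r \<in> carrier R; x \<in> carrier A\<rbrakk> \<Longrightarrow> f (r \<odot>\<^bsub>A\<^esub> x) = r \<odot>\<^bsub>B\<^esub> f x"
  shows "restrict f (carrier A) \<in> nonassoc_hom R A B"
proof -
  interpret nonassoc_algebra R A by fact
  show ?thesis
    using assms(2-) by (auto simp: nonassoc_hom_def mult_closed)
qed

lemma nonassoc_iso_inverse:
  assumes A: "nonassoc_algebra R A" and B: "nonassoc_algebra R B"
    and f: "f \<in> nonassoc_iso R A B"
  shows "restrict (inv_into (carrier A) f) (carrier B) \<in> nonassoc_hom R B A"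
proof (rule restrict_in_nonassoc_hom[OF B])
  interpret A: nonassoc_algebra R A by fact
  interpret B: nonassoc_algebra R B by fact
  have hom: "f \<in> nonassoc_hom R A B" and bij: "bij_betw f (carrier A) (carrier B)"
    using f by (auto simp: nonassoc_iso_def)
  let ?g = "inv_into (carrier A) f"
  have g: "?g y \<in> carrier A" and fg: "f (?g y) = y" if "y \<in> carrier B" for y
    using bij that by (auto simp: bij_betw_def inv_into_into f_inv_into_f)
  have eqI: "?g y = x" if "x \<in> carrier A" "y = f x" for x y
    using bij that by (simp add: bij_betw_def inv_into_f_f)
  show "?g y \<in> carrier A" if "y \<in> carrier B" for y by (rule g[OF that])
  show "?g (x \<oplus>\<^bsub>B\<^esub> y) = ?g x \<oplus>\<^bsub>A\<^esub> ?g y" if "x \<in> carrier B" "y \<in> carrier B" for x y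
    by (rule eqI) (use that g fg nonassoc_homD(3)[OF hom] in auto)
  show "?g (x \<otimes>\<^bsub>B\<^esub> y) = ?g x \<otimes>\<^bsub>A\<^esub> ?g y" if "x \<in> carrier B" "y \<in> carrier B" for x y
    by (rule eqI) (use that g fg nonassoc_homD(4)[OF hom] A.mult_closed in auto)
  show "?g (r \<odot>\<^bsub>B\<^esub> x) = r \<odot>\<^bsub>A\<^esub> ?g x" if "r \<in> carrier R" "x \<in> carrier B" for r x
    by (rule eqI) (use that g fg nonassoc_homD(5)[OF hom] in auto)
qed

text \<open>
  An arrow \<open>F(\<phi>)\<close> joins algebras over different rings and respects their scalars only along \<open>\<phi>\<close>.  Both sides of
  \<open>h \<circ> F(\<phi>) = G(\<phi>) \<circ> \<theta>\<close> live here, together with the ordinary linear maps (\<open>\<phi> = id\<close>).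
\<close>

definition semilinear_maps ::
    "('r, 'm) ring_scheme \<Rightarrow> ('r \<Rightarrow> 'r) \<Rightarrow> ('r, 'a) module \<Rightarrow> ('r, 'b) module \<Rightarrow> ('a \<Rightarrow> 'b) set" where
  "semilinear_maps R \<phi> M N =
     {g \<in> carrier M \<rightarrow> carrier N.
        (\<forall>x\<in>carrier M. \<forall>y\<in>carrier M. g (x \<oplus>\<^bsub>M\<^esub> y) = g x \<oplus>\<^bsub>N\<^esub> g y) \<and>
        (\<forall>r\<in>carrier R. \<forall>x\<in>carrier M. g (r \<odot>\<^bsub>M\<^esub> x) = \<phi> r \<odot>\<^bsub>N\<^esub> g x)}"

lemma semilinear_mapsD:
  assumes "g \<in> semilinear_maps R \<phi> M N"
  shows "x \<in> carrier M \<Longrightarrow> g x \<in> carrier N"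
    and "\<lbrakk>x \<in> carrier M; y \<in> carrier M\<rbrakk> \<Longrightarrow> g (x \<oplus>\<^bsub>M\<^esub> y) = g x \<oplus>\<^bsub>N\<^esub> g y"
    and "\<lbrakk>r \<in> carrier R; x \<in> carrier M\<rbrakk> \<Longrightarrow> g (r \<odot>\<^bsub>M\<^esub> x) = \<phi> r \<odot>\<^bsub>N\<^esub> g x"
  using assms by (auto simp: semilinear_maps_def)

lemma nonassoc_hom_semilinear: "f \<in> nonassoc_hom R M N \<Longrightarrow> f \<in> semilinear_maps R id M N"
  by (auto simp: nonassoc_hom_def semilinear_maps_def)

lemma semilinear_comp:
  assumes "f \<in> semilinear_maps R \<phi> L M" "g \<in> semilinear_maps S \<chi> M N"
    and "\<And>r. r \<in> carrier R \<Longrightarrow> \<phi> r \<in> carrier S"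
  shows "g \<circ> f \<in> semilinear_maps R (\<chi> \<circ> \<phi>) L N"
  using assms by (auto simp: semilinear_maps_def Pi_iff)

section \<open>Formal sums and their classes\<close>

lemma mem_tensor_free [simp]:
  "x \<in> carrier (tensor_free A R) \<longleftrightarrow> Poly_Mapping.keys x \<subseteq> carrier A \<times> carrier R"
  by (simp add: tensor_free_def)

lemma tensor_free_simps [simp]:
  "x \<otimes>\<^bsub>tensor_free A R\<^esub> y = x + y" "\<one>\<^bsub>tensor_free A R\<^esub> = 0"
  "Poly_Mapping.keys x \<subseteq> carrier A \<times> carrier R \<Longrightarrow> inv\<^bsub>tensor_free A R\<^esub> x = - x"
  by (simp_all add: tensor_free_def)

lemma comm_group_tensor_free: "comm_group (tensor_free A R)"
  by (simp add: tensor_free_def abelian_free_Abelian_group)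

lemmas formal_induct [consumes 1, case_names zero diff single] = free_Abelian_group_induct

lemma keys_subset_diff:
  "\<lbrakk>Poly_Mapping.keys x \<subseteq> S; Poly_Mapping.keys y \<subseteq> S\<rbrakk> \<Longrightarrow>
   Poly_Mapping.keys (x - y :: 'a \<Rightarrow>\<^sub>0 int) \<subseteq> S"
  using keys_diff[of x y] by blast

lemma keys_subset_add:
  "\<lbrakk>Poly_Mapping.keys x \<subseteq> S; Poly_Mapping.keys y \<subseteq> S\<rbrakk> \<Longrightarrow>
   Poly_Mapping.keys (x + y :: 'a \<Rightarrow>\<^sub>0 int) \<subseteq> S"
  using keys_add[of x y] by blast

lemma keys_frag_extend_subset:
  "\<lbrakk>Poly_Mapping.keys x \<subseteq> S; \<And>a. a \<in> S \<Longrightarrow> Poly_Mapping.keys (f a) \<subseteq> T\<rbrakk> \<Longrightarrow>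
   Poly_Mapping.keys (frag_extend f x) \<subseteq> T"
  using keys_frag_extend[of f x] by blast

text \<open>
  The common shape of the scalar action on formal sums (\<open>f\<close> is multiplication by \<open>t\<close>) and of the map
  \<open>1 \<otimes> \<alpha>\<close> (\<open>f\<close> is \<open>\<alpha>\<close>).  That the two interact correctly is then one lemma about composition.
\<close>

definition map_coeffs :: "('r \<Rightarrow> 's) \<Rightarrow> ('a \<times> 'r \<Rightarrow>\<^sub>0 int) \<Rightarrow> ('a \<times> 's \<Rightarrow>\<^sub>0 int)" where
  "map_coeffs f = frag_extend (\<lambda>(a, r). frag_of (a, f r))"

lemma map_coeffs_simps [simp]:
  "map_coeffs f 0 = 0"
  "map_coeffs f (frag_of (a, r)) = frag_of (a, f r)"
  "map_coeffs f (x - y) = map_coeffs f x - map_coeffs f y"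
  by (simp_all add: map_coeffs_def frag_extend_diff)

lemma keys_map_coeffs:
  assumes "Poly_Mapping.keys x \<subseteq> A \<times> R" "\<And>r. r \<in> R \<Longrightarrow> f r \<in> S"
  shows "Poly_Mapping.keys (map_coeffs f x) \<subseteq> A \<times> S"
  unfolding map_coeffs_def by (rule keys_frag_extend_subset[OF assms(1)]) (use assms(2) in auto)

lemma map_coeffs_commute:
  assumes "Poly_Mapping.keys x \<subseteq> A \<times> R" "\<And>r. r \<in> R \<Longrightarrow> f (g r) = g' (f' r)"
  shows "map_coeffs f (map_coeffs g x) = map_coeffs g' (map_coeffs f' x)"
  using assms(1) by (induction x rule: frag_induction) (use assms(2) in auto)

lemma keys_formal_mult:
  assumes "nonassoc_algebra K A" "algebra K R"
    and "Poly_Mapping.keys x \<subseteq> carrier A \<times> carrier R" "Poly_Mapping.keys y \<subseteq> carrier A \<times> carrier R"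
  shows "Poly_Mapping.keys (formal_mult A R x y) \<subseteq> carrier A \<times> carrier R"
proof -
  interpret A: nonassoc_algebra K A by fact
  interpret R: algebra K R by fact
  show ?thesis
    unfolding formal_mult_def
    by (intro keys_frag_extend_subset[OF assms(3)])
      (auto intro!: keys_frag_extend_subset[OF assms(4)] simp: A.mult_closed)
qed

lemma hom_formal_diff:
  assumes "abelian_group N" "h \<in> hom (tensor_free A R) (add_monoid N)"
    and "Poly_Mapping.keys x \<subseteq> carrier A \<times> carrier R" "Poly_Mapping.keys y \<subseteq> carrier A \<times> carrier R"
  shows "h (x - y) = h x \<ominus>\<^bsub>N\<^esub> h y"
proof -
  interpret N: abelian_group N by fact
  interpret F: comm_group "tensor_free A R" by (rule comm_group_tensor_free)
  have "group_hom (tensor_free A R) (add_monoid N) h"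
    using assms(2) N.a_group by unfold_locales auto
  then interpret h: group_hom "tensor_free A R" "add_monoid N" h .
  have "h (x + (- y)) = h x \<oplus>\<^bsub>N\<^esub> h (- y)"
    using h.hom_mult[of x "- y"] assms(3,4) by simp
  moreover have "h (- y) = \<ominus>\<^bsub>N\<^esub> h y"
    using h.hom_inv[of y] assms(4) by (simp add: a_inv_def)
  ultimately show ?thesis
    by (simp add: a_minus_def)
qed

lemma hom_formal:
  assumes "abelian_group N" "h \<in> hom (tensor_free A R) (add_monoid N)"
  shows "h 0 = \<zero>\<^bsub>N\<^esub>"
    and "Poly_Mapping.keys x \<subseteq> carrier A \<times> carrier R \<Longrightarrow> h x \<in> carrier N"
proof -
  show *: "h x \<in> carrier N" if "Poly_Mapping.keys x \<subseteq> carrier A \<times> carrier R" for x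
    using assms(2) that by (auto simp: hom_def)
  interpret N: abelian_group N by fact
  show "h 0 = \<zero>\<^bsub>N\<^esub>"
    using hom_formal_diff[OF assms, of 0 0] * by (simp add: N.r_neg a_minus_def)
qed

lemma (in abelian_group) minus_diff_diff:
  "\<lbrakk>x \<in> carrier G; y \<in> carrier G; z \<in> carrier G\<rbrakk> \<Longrightarrow> x \<ominus> y \<ominus> z = x \<ominus> (y \<oplus> z)"
  by (simp add: a_minus_def minus_add a_assoc)

lemma (in abelian_group) eq_if_diff_zero:
  assumes "x \<ominus> y = \<zero>" "x \<in> carrier G" "y \<in> carrier G"
  shows "x = y"
proof -
  have "x = (x \<ominus> y) \<oplus> y"
    using assms(2,3) by (simp add: a_minus_def a_assoc l_neg)
  then show ?thesis
    using assms by simp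
qed

text \<open>
  Negation is the action of the scalar \<open>-1\<close>, which passes through products.
\<close>

lemma (in nonassoc_algebra) mult_minus:
  assumes "x \<in> carrier M" "y \<in> carrier M"
  shows "x \<otimes>\<^bsub>M\<^esub> (\<ominus>\<^bsub>M\<^esub> y) = \<ominus>\<^bsub>M\<^esub> (x \<otimes>\<^bsub>M\<^esub> y)" "(\<ominus>\<^bsub>M\<^esub> x) \<otimes>\<^bsub>M\<^esub> y = \<ominus>\<^bsub>M\<^esub> (x \<otimes>\<^bsub>M\<^esub> y)"
  using assms mult_smult_r[of "\<ominus> \<one>" x y] mult_smult_l[of "\<ominus> \<one>" x y] mult_closed
  by (simp_all add: smult_l_minus)

lemma (in nonassoc_algebra) mult_diff:
  assumes "x \<in> carrier M" "y \<in> carrier M" "z \<in> carrier M"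
  shows "x \<otimes>\<^bsub>M\<^esub> (y \<ominus>\<^bsub>M\<^esub> z) = x \<otimes>\<^bsub>M\<^esub> y \<ominus>\<^bsub>M\<^esub> x \<otimes>\<^bsub>M\<^esub> z"
    and "(y \<ominus>\<^bsub>M\<^esub> z) \<otimes>\<^bsub>M\<^esub> x = y \<otimes>\<^bsub>M\<^esub> x \<ominus>\<^bsub>M\<^esub> z \<otimes>\<^bsub>M\<^esub> x"
  using assms by (simp_all add: a_minus_def mult_l_distr mult_r_distr mult_minus)

lemma (in nonassoc_algebra) mult_null:
  assumes "x \<in> carrier M"
  shows "x \<otimes>\<^bsub>M\<^esub> \<zero>\<^bsub>M\<^esub> = \<zero>\<^bsub>M\<^esub>" "\<zero>\<^bsub>M\<^esub> \<otimes>\<^bsub>M\<^esub> x = \<zero>\<^bsub>M\<^esub>"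
  using assms mult_diff[of x x x] mult_closed[of x x] by (simp_all add: a_minus_def M.r_neg)

lemma tensor_relators_closed:
  assumes "nonassoc_algebra K A" "algebra K R"
  shows "tensor_relators K A R \<subseteq> carrier (tensor_free A R)"
proof -
  interpret A: nonassoc_algebra K A by fact
  interpret R: algebra K R by fact
  show ?thesis
    unfolding tensor_relators_def
    by (auto dest!: subsetD[OF keys_diff])
qed

lemma tensor_ker_normal:
  assumes "nonassoc_algebra K A" "algebra K R"
  shows "tensor_ker K A R \<lhd> tensor_free A R"
proof -
  interpret F: comm_group "tensor_free A R" by (rule comm_group_tensor_free)
  show ?thesis
    unfolding tensor_ker_def
    by (intro F.subgroup_imp_normal F.generate_is_subgroup tensor_relators_closed assms)
qed

lemma rcoset_eq_of_subset:
  assumes "group G" "subgroup H G" "C \<in> rcosets\<^bsub>G\<^esub> H" "x \<in> carrier G" "H #>\<^bsub>G\<^esub> x \<subseteq> C"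
  shows "H #>\<^bsub>G\<^esub> x = C"
proof -
  interpret group G by fact
  have "x \<in> C"
    using assms rcos_self by blast
  moreover obtain y where "y \<in> carrier G" "C = H #>\<^bsub>G\<^esub> y"
    using assms(3) by (auto simp: RCOSETS_def)
  ultimately show ?thesis
    using repr_independence[of x H y] assms(2) by simp
qed

section \<open>Presentations of scalar extensions\<close>

text \<open>
  \<open>M\<close> is a copy of \<open>A \<otimes>\<^sub>K R\<close>, with \<open>\<pi>\<close> sending a formal sum of pairs \<open>(a, r)\<close> to the sum of the
  tensors \<open>a \<otimes> r\<close>.  The universal property quantifies over algebras of every type and so cannot be an
  assumption of a locale; a presentation by generators and relations can, and implies it.
\<close>

locale scalar_extension =
  base: nonassoc_algebra K A + scalars: algebra K R + ext: nonassoc_algebra R M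
  for K :: "'r ring" and A :: "('r, 'a) module" and R :: "('r, 'r) module" and M :: "('r, 'b) module"
    and \<pi> :: "('a \<times> 'r \<Rightarrow>\<^sub>0 int) \<Rightarrow> 'b" +
  assumes proj_hom: "\<pi> \<in> hom (tensor_free A R) (add_monoid M)"
    and proj_surj: "\<pi> ` carrier (tensor_free A R) = carrier M"
    and proj_kernel: "x \<in> carrier (tensor_free A R) \<Longrightarrow> \<pi> x = \<zero>\<^bsub>M\<^esub> \<longleftrightarrow> x \<in> tensor_ker K A R"
    and proj_mult: "\<lbrakk>x \<in> carrier (tensor_free A R); y \<in> carrier (tensor_free A R)\<rbrakk> \<Longrightarrow>
      \<pi> (formal_mult A R x y) = \<pi> x \<otimes>\<^bsub>M\<^esub> \<pi> y"
    and proj_smult: "\<lbrakk>t \<in> carrier R; x \<in> carrier (tensor_free A R)\<rbrakk> \<Longrightarrow>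
      \<pi> (map_coeffs ((\<otimes>\<^bsub>R\<^esub>) t) x) = t \<odot>\<^bsub>M\<^esub> \<pi> x"
begin

abbreviation tensor (infix "\<otimes>\<otimes>" 75) where
  "a \<otimes>\<otimes> r \<equiv> \<pi> (frag_of (a, r))"

lemma proj_diff:
  "\<lbrakk>x \<in> carrier (tensor_free A R); y \<in> carrier (tensor_free A R)\<rbrakk> \<Longrightarrow> \<pi> (x - y) = \<pi> x \<ominus>\<^bsub>M\<^esub> \<pi> y"
  using hom_formal_diff[OF ext.abelian_group_axioms proj_hom] by simp

lemma proj_closed: "x \<in> carrier (tensor_free A R) \<Longrightarrow> \<pi> x \<in> carrier M"
  using proj_surj by blast

lemma proj_cases:
  assumes "m \<in> carrier M"
  shows "\<exists>x. Poly_Mapping.keys x \<subseteq> carrier A \<times> carrier R \<and> m = \<pi> x"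
proof -
  have "m \<in> \<pi> ` carrier (tensor_free A R)"
    using assms proj_surj by simp
  then show ?thesis
    by (elim imageE) auto
qed

lemma tensor_closed: "\<lbrakk>a \<in> carrier A; r \<in> carrier R\<rbrakk> \<Longrightarrow> a \<otimes>\<otimes> r \<in> carrier M"
  by (rule proj_closed) simp


lemma tensor_smult:
  "\<lbrakk>t \<in> carrier R; a \<in> carrier A; r \<in> carrier R\<rbrakk> \<Longrightarrow> t \<odot>\<^bsub>M\<^esub> (a \<otimes>\<otimes> r) = a \<otimes>\<otimes> (t \<otimes>\<^bsub>R\<^esub> r)"
  using proj_smult[of t "frag_of (a, r)"] by simp

lemma tensor_mult:
  "\<lbrakk>a \<in> carrier A; r \<in> carrier R; b \<in> carrier A; s \<in> carrier R\<rbrakk> \<Longrightarrow>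
   (a \<otimes>\<otimes> r) \<otimes>\<^bsub>M\<^esub> (b \<otimes>\<otimes> s) = (a \<otimes>\<^bsub>A\<^esub> b) \<otimes>\<otimes> (r \<otimes>\<^bsub>R\<^esub> s)"
  using proj_mult[of "frag_of (a, r)" "frag_of (b, s)"] by (simp add: formal_mult_def)

lemma proj_relator:
  assumes "x \<in> tensor_relators K A R"
  shows "\<pi> x = \<zero>\<^bsub>M\<^esub>"
proof -
  have "x \<in> carrier (tensor_free A R)" "x \<in> tensor_ker K A R"
    using assms tensor_relators_closed[OF base.nonassoc_algebra_axioms scalars.algebra_axioms]
    unfolding tensor_ker_def by (blast, intro generate.incl)
  then show ?thesis
    using proj_kernel by blast
qed

lemma tensor_add_left:
  assumes "a \<in> carrier A" "b \<in> carrier A" "r \<in> carrier R"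
  shows "(a \<oplus>\<^bsub>A\<^esub> b) \<otimes>\<otimes> r = (a \<otimes>\<otimes> r) \<oplus>\<^bsub>M\<^esub> (b \<otimes>\<otimes> r)"
proof -
  have "\<pi> (frag_of (a \<oplus>\<^bsub>A\<^esub> b, r) - frag_of (a, r) - frag_of (b, r)) = \<zero>\<^bsub>M\<^esub>"
    by (rule proj_relator) (use assms in \<open>auto simp: tensor_relators_def\<close>)
  then have "(a \<oplus>\<^bsub>A\<^esub> b) \<otimes>\<otimes> r \<ominus>\<^bsub>M\<^esub> (a \<otimes>\<otimes> r \<oplus>\<^bsub>M\<^esub> b \<otimes>\<otimes> r) = \<zero>\<^bsub>M\<^esub>"
    using assms by (simp add: proj_diff keys_subset_diff tensor_closed ext.minus_diff_diff)
  then show ?thesis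
    using assms by (auto intro!: tensor_closed ext.add.m_closed dest!: ext.eq_if_diff_zero)
qed

lemma tensor_balanced:
  assumes "k \<in> carrier K" "a \<in> carrier A" "r \<in> carrier R"
  shows "(k \<odot>\<^bsub>A\<^esub> a) \<otimes>\<otimes> r = a \<otimes>\<otimes> (k \<odot>\<^bsub>R\<^esub> r)"
proof (rule ext.eq_if_diff_zero)
  have "\<pi> (frag_of (k \<odot>\<^bsub>A\<^esub> a, r) - frag_of (a, k \<odot>\<^bsub>R\<^esub> r)) = \<zero>\<^bsub>M\<^esub>"
    by (rule proj_relator) (use assms in \<open>auto simp: tensor_relators_def\<close>)
  then show "(k \<odot>\<^bsub>A\<^esub> a) \<otimes>\<otimes> r \<ominus>\<^bsub>M\<^esub> a \<otimes>\<otimes> (k \<odot>\<^bsub>R\<^esub> r) = \<zero>\<^bsub>M\<^esub>"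
    using assms by (simp add: proj_diff)
qed (use assms in \<open>auto intro: tensor_closed\<close>)

text \<open>
  The unit of the adjunction between extension and restriction of scalars.
\<close>

definition unit_map :: "'a \<Rightarrow> 'b" where
  "unit_map = (\<lambda>a\<in>carrier A. a \<otimes>\<otimes> \<one>\<^bsub>R\<^esub>)"

lemma unit_map_apply: "a \<in> carrier A \<Longrightarrow> unit_map a = a \<otimes>\<otimes> \<one>\<^bsub>R\<^esub>"
  by (simp add: unit_map_def)

lemma tensor_eq_smult_unit:
  "\<lbrakk>a \<in> carrier A; r \<in> carrier R\<rbrakk> \<Longrightarrow> a \<otimes>\<otimes> r = r \<odot>\<^bsub>M\<^esub> unit_map a"
  by (simp add: unit_map_apply tensor_smult)

lemma unit_map_hom: "unit_map \<in> nonassoc_hom K A (restrict_scalars R M)"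
  unfolding unit_map_def
  by (rule restrict_in_nonassoc_hom[OF base.nonassoc_algebra_axioms])
    (auto simp: restrict_scalars_def tensor_closed tensor_add_left tensor_mult tensor_balanced
      tensor_smult)

text \<open>
  Uniqueness: \<open>a \<otimes> r = r (a \<otimes> 1)\<close>, so a semilinear map is determined on all pure tensors by its values on
  the unit, and the pure tensors generate \<open>M\<close> as a group.
\<close>

lemma semilinear_eqI:
  assumes N: "abelian_group N"
    and u: "u \<in> semilinear_maps R \<phi> M N" and v: "v \<in> semilinear_maps R \<phi> M N"
    and eq: "\<And>a. a \<in> carrier A \<Longrightarrow> u (unit_map a) = v (unit_map a)"
    and m: "m \<in> carrier M"
  shows "u m = v m"
proof -
  have hom: "w \<circ> \<pi> \<in> hom (tensor_free A R) (add_monoid N)" if "w \<in> semilinear_maps R \<phi> M N" for w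
    using proj_hom proj_closed semilinear_mapsD[OF that]
    by (auto simp: hom_def simp del: mem_tensor_free)
  note hom_diff = hom_formal_diff[OF N hom, unfolded o_apply]
  note hom_zero = hom_formal(1)[OF N hom, unfolded o_apply]
  obtain x where x: "Poly_Mapping.keys x \<subseteq> carrier A \<times> carrier R" and "m = \<pi> x"
    using proj_cases[OF m] by blast
  have "u (\<pi> x) = v (\<pi> x)"
    using x
  proof (induction x rule: formal_induct)
    case zero
    then show ?case by (simp add: hom_zero[OF u] hom_zero[OF v])
  next
    case (diff x y)
    then show ?case by (simp add: hom_diff[OF u] hom_diff[OF v])
  next
    case (single p)
    then obtain a r where p: "p = (a, r)" "a \<in> carrier A" "r \<in> carrier R" by auto
    then have "unit_map a \<in> carrier M"
      by (simp add: unit_map_apply tensor_closed)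
    with p eq show ?case
      by (simp add: tensor_eq_smult_unit semilinear_mapsD(3)[OF u] semilinear_mapsD(3)[OF v])
  qed
  with \<open>m = \<pi> x\<close> show ?thesis by simp
qed

text \<open>
  Existence: send \<open>(a, r)\<close> to \<open>r f(a)\<close>.  The balancing relations are respected because \<open>k \<in> K\<close> acts
  on \<open>N\<close> as \<open>k \<cdot> 1\<^sub>R\<close>, which commutes with \<open>r\<close>.  On pure tensors the multiplicativity is
  \<open>(r f(a)) (s f(b)) = r s f(a b)\<close>; both sides being biadditive, it spreads to all formal sums.
\<close>

lemma nonassoc_hom_lift:
  assumes N: "nonassoc_algebra R N" and f: "f \<in> nonassoc_hom K A (restrict_scalars R N)"
  obtains h where "h \<in> nonassoc_hom R M N" "\<And>a. a \<in> carrier A \<Longrightarrow> h (unit_map a) = f a"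
proof -
  interpret N: nonassoc_algebra R N by fact
  have f_closed: "f a \<in> carrier N" if "a \<in> carrier A" for a
    using nonassoc_homD(2)[OF f that] by (simp add: restrict_scalars_def)
  have f_add: "f (a \<oplus>\<^bsub>A\<^esub> b) = f a \<oplus>\<^bsub>N\<^esub> f b" and f_mult: "f (a \<otimes>\<^bsub>A\<^esub> b) = f a \<otimes>\<^bsub>N\<^esub> f b"
    if "a \<in> carrier A" "b \<in> carrier A" for a b
    using nonassoc_homD(3,4)[OF f that] by (simp_all add: restrict_scalars_def)
  have f_smult: "f (k \<odot>\<^bsub>A\<^esub> a) = (k \<odot>\<^bsub>R\<^esub> \<one>\<^bsub>R\<^esub>) \<odot>\<^bsub>N\<^esub> f a" if "k \<in> carrier K" "a \<in> carrier A" for k a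
    using nonassoc_homD(5)[OF f that] by (simp add: restrict_scalars_def)
  have "(\<lambda>(a, r). r \<odot>\<^bsub>N\<^esub> f a) ` (carrier A \<times> carrier R) \<subseteq> carrier (add_monoid N)"
    by (auto simp: f_closed)
  from comm_group.free_Abelian_group_universal[OF N.a_comm_group this] obtain F
    where F: "F \<in> hom (tensor_free A R) (add_monoid N)"
      and F_of: "\<And>a r. \<lbrakk>a \<in> carrier A; r \<in> carrier R\<rbrakk> \<Longrightarrow> F (frag_of (a, r)) = r \<odot>\<^bsub>N\<^esub> f a"
    unfolding tensor_free_def by (metis (no_types, lifting) SigmaI case_prod_conv)
  note F_diff = hom_formal_diff[OF N.abelian_group_axioms F]
  note F_zero = hom_formal(1)[OF N.abelian_group_axioms F]
  note F_closed = hom_formal(2)[OF N.abelian_group_axioms F]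
  interpret FR: comm_group "tensor_free A R" by (rule comm_group_tensor_free)
  interpret F: group_hom "tensor_free A R" "add_monoid N" F
    using F by unfold_locales auto
  have relator: "F x = \<zero>\<^bsub>N\<^esub>" if "x \<in> tensor_relators K A R" for x
    using that unfolding tensor_relators_def
  proof (elim UnE CollectE exE conjE)
    fix a b r assume *: "x = frag_of (a \<oplus>\<^bsub>A\<^esub> b, r) - frag_of (a, r) - frag_of (b, r)"
      "a \<in> carrier A" "b \<in> carrier A" "r \<in> carrier R"
    then have "F x = (r \<odot>\<^bsub>N\<^esub> f a \<oplus>\<^bsub>N\<^esub> r \<odot>\<^bsub>N\<^esub> f b) \<ominus>\<^bsub>N\<^esub> (r \<odot>\<^bsub>N\<^esub> f a \<oplus>\<^bsub>N\<^esub> r \<odot>\<^bsub>N\<^esub> f b)"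
      by (simp add: N.minus_diff_diff F_diff F_of keys_subset_diff f_add f_closed N.smult_r_distr)
    with * show ?thesis
      by (simp add: a_minus_def N.r_neg f_closed)
  next
    fix a r s assume *: "x = frag_of (a, r \<oplus>\<^bsub>R\<^esub> s) - frag_of (a, r) - frag_of (a, s)"
      "a \<in> carrier A" "r \<in> carrier R" "s \<in> carrier R"
    then have "F x = (r \<odot>\<^bsub>N\<^esub> f a \<oplus>\<^bsub>N\<^esub> s \<odot>\<^bsub>N\<^esub> f a) \<ominus>\<^bsub>N\<^esub> (r \<odot>\<^bsub>N\<^esub> f a \<oplus>\<^bsub>N\<^esub> s \<odot>\<^bsub>N\<^esub> f a)"
      by (simp add: N.minus_diff_diff F_diff F_of keys_subset_diff f_closed N.smult_l_distr)
    with * show ?thesis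
      by (simp add: a_minus_def N.r_neg f_closed)
  next
    fix k a r assume *: "x = frag_of (k \<odot>\<^bsub>A\<^esub> a, r) - frag_of (a, k \<odot>\<^bsub>R\<^esub> r)"
      "k \<in> carrier K" "a \<in> carrier A" "r \<in> carrier R"
    have "r \<otimes>\<^bsub>R\<^esub> (k \<odot>\<^bsub>R\<^esub> \<one>\<^bsub>R\<^esub>) = k \<odot>\<^bsub>R\<^esub> r"
      using * scalars.smult_assoc2[of k "\<one>\<^bsub>R\<^esub>" r] by (simp add: scalars.m_comm)
    then have "r \<odot>\<^bsub>N\<^esub> f (k \<odot>\<^bsub>A\<^esub> a) = (k \<odot>\<^bsub>R\<^esub> r) \<odot>\<^bsub>N\<^esub> f a"
      using * by (simp add: f_smult f_closed N.smult_assoc1[symmetric])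
    with * show ?thesis
      by (simp add: F_diff F_of f_closed a_minus_def N.r_neg)
  qed
  have "tensor_ker K A R \<subseteq> kernel (tensor_free A R) (add_monoid N) F"
    unfolding tensor_ker_def
    by (rule FR.generate_subgroup_incl[OF _ F.subgroup_kernel])
      (use relator tensor_relators_closed[OF base.nonassoc_algebra_axioms scalars.algebra_axioms]
        in \<open>auto simp: kernel_def simp del: mem_tensor_free\<close>)
  then have F_ker: "F x = \<zero>\<^bsub>N\<^esub>" if "x \<in> tensor_ker K A R" for x
    using that by (auto simp: kernel_def)
  \<comment> \<open>Any choice of preimage under \<open>\<pi>\<close> works, as \<open>F\<close> vanishes on the kernel of \<open>\<pi>\<close>.\<close>
  define h where "h = F \<circ> inv_into (carrier (tensor_free A R)) \<pi>"
  have h: "h (\<pi> x) = F x" if x: "x \<in> carrier (tensor_free A R)" for x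
  proof -
    define y where "y = inv_into (carrier (tensor_free A R)) \<pi> (\<pi> x)"
    have y: "y \<in> carrier (tensor_free A R)" "\<pi> y = \<pi> x"
      unfolding y_def using x by (auto intro: inv_into_into f_inv_into_f simp del: mem_tensor_free)
    then have "\<pi> (y - x) = \<zero>\<^bsub>M\<^esub>"
      using x proj_closed[OF x] by (simp add: proj_diff a_minus_def ext.r_neg)
    then have "F (y - x) = \<zero>\<^bsub>N\<^esub>"
      using x y by (intro F_ker proj_kernel[THEN iffD1]) (simp_all add: keys_subset_diff)
    then have "F y \<ominus>\<^bsub>N\<^esub> F x = \<zero>\<^bsub>N\<^esub>"
      using x y by (simp add: F_diff)
    then have "F y = F x"
      using x y by (auto simp: F_closed dest!: N.eq_if_diff_zero)
    then show ?thesis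
      by (simp add: h_def y_def)
  qed
  have F_smult: "F (map_coeffs ((\<otimes>\<^bsub>R\<^esub>) t) x) = t \<odot>\<^bsub>N\<^esub> F x"
    if t: "t \<in> carrier R" and x: "Poly_Mapping.keys x \<subseteq> carrier A \<times> carrier R" for t x
    using x
  proof (induction x rule: formal_induct)
    case zero
    then show ?case using t by (simp add: F_zero)
  next
    case (diff x y)
    moreover have "Poly_Mapping.keys (map_coeffs ((\<otimes>\<^bsub>R\<^esub>) t) z) \<subseteq> carrier A \<times> carrier R"
      if "Poly_Mapping.keys z \<subseteq> carrier A \<times> carrier R" for z
      using that t by (intro keys_map_coeffs) auto
    ultimately show ?case
      using t by (simp add: F_diff F_closed a_minus_def N.smult_r_distr N.smult_r_minus)
  next
    case (single p)
    then show ?case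
      using t by (auto simp: F_of f_closed N.smult_assoc1)
  qed
  have F_mult_of: "F (formal_mult A R (frag_of (a, r)) y) = (r \<odot>\<^bsub>N\<^esub> f a) \<otimes>\<^bsub>N\<^esub> F y"
    if a: "a \<in> carrier A" and r: "r \<in> carrier R" and y: "Poly_Mapping.keys y \<subseteq> carrier A \<times> carrier R" for a r y
    using y
  proof (induction y rule: formal_induct)
    case zero
    then show ?case using a r by (simp add: formal_mult_def F_zero f_closed N.mult_null)
  next
    case (diff x y)
    have "formal_mult A R (frag_of (a, r)) (x - y) =
        formal_mult A R (frag_of (a, r)) x - formal_mult A R (frag_of (a, r)) y"
      by (simp add: formal_mult_def frag_extend_diff)
    with diff show ?case
      using a r by (simp add: F_diff F_closed f_closed N.mult_diff
          keys_formal_mult[OF base.nonassoc_algebra_axioms scalars.algebra_axioms])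
  next
    case (single p)
    then show ?case
      using a r by (auto simp: formal_mult_def F_of f_closed f_mult base.mult_closed
          N.mult_smult_l N.mult_smult_r N.smult_assoc1[symmetric] N.mult_closed scalars.m_comm)
  qed
  have F_mult: "F (formal_mult A R x y) = F x \<otimes>\<^bsub>N\<^esub> F y"
    if x: "Poly_Mapping.keys x \<subseteq> carrier A \<times> carrier R"
      and y: "Poly_Mapping.keys y \<subseteq> carrier A \<times> carrier R" for x y
    using x
  proof (induction x rule: formal_induct)
    case zero
    then show ?case using y by (simp add: formal_mult_def F_zero F_closed N.mult_null)
  next
    case (diff x x')
    have "formal_mult A R (x - x') y = formal_mult A R x y - formal_mult A R x' y"
      by (simp add: formal_mult_def frag_extend_diff)
    with diff show ?case
      using y by (simp add: F_diff F_closed N.mult_diff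
          keys_formal_mult[OF base.nonassoc_algebra_axioms scalars.algebra_axioms])
  next
    case (single p)
    then show ?case
      using y by (auto simp: F_mult_of F_of)
  qed
  have "restrict h (carrier M) \<in> nonassoc_hom R M N"
  proof (rule restrict_in_nonassoc_hom[OF ext.nonassoc_algebra_axioms])
    fix m assume "m \<in> carrier M"
    then show "h m \<in> carrier N"
      using proj_cases F_closed h by force
  next
    fix m n assume "m \<in> carrier M" "n \<in> carrier M"
    then obtain x y where x: "Poly_Mapping.keys x \<subseteq> carrier A \<times> carrier R" "m = \<pi> x"
      and y: "Poly_Mapping.keys y \<subseteq> carrier A \<times> carrier R" "n = \<pi> y"
      using proj_cases by metis
    have "\<pi> (x + y) = m \<oplus>\<^bsub>M\<^esub> n" "F (x + y) = F x \<oplus>\<^bsub>N\<^esub> F y"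
      using proj_hom F x y by (auto simp: hom_def)
    moreover have "\<pi> (formal_mult A R x y) = m \<otimes>\<^bsub>M\<^esub> n"
      using proj_mult x y by simp
    ultimately show "h (m \<oplus>\<^bsub>M\<^esub> n) = h m \<oplus>\<^bsub>N\<^esub> h n" "h (m \<otimes>\<^bsub>M\<^esub> n) = h m \<otimes>\<^bsub>N\<^esub> h n"
      using x y h[of "x + y"] h[of "formal_mult A R x y"] h[of x] h[of y] keys_subset_add[of x _ y]
      by (simp_all add: F_mult keys_formal_mult[OF base.nonassoc_algebra_axioms scalars.algebra_axioms])
  next
    fix t m assume t: "t \<in> carrier R" and "m \<in> carrier M"
    then obtain x where x: "Poly_Mapping.keys x \<subseteq> carrier A \<times> carrier R" "m = \<pi> x"
      using proj_cases by metis
    then have "Poly_Mapping.keys (map_coeffs ((\<otimes>\<^bsub>R\<^esub>) t) x) \<subseteq> carrier A \<times> carrier R"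
      using t by (intro keys_map_coeffs) auto
    then show "h (t \<odot>\<^bsub>M\<^esub> m) = t \<odot>\<^bsub>N\<^esub> h m"
      using t x h[of x] h[of "map_coeffs ((\<otimes>\<^bsub>R\<^esub>) t) x"] by (simp add: proj_smult F_smult)
  qed
  moreover have "restrict h (carrier M) (unit_map a) = f a" if "a \<in> carrier A" for a
    using that h[of "frag_of (a, \<one>\<^bsub>R\<^esub>)"] by (simp add: unit_map_apply tensor_closed F_of f_closed)
  ultimately show thesis
    by (rule that)
qed

end


section \<open>The presentation carried by the tensor product\<close>

lemma tensor_algebra_simps:
  "carrier (tensor_algebra K A R) = rcosets\<^bsub>tensor_free A R\<^esub> tensor_ker K A R"
  "X \<oplus>\<^bsub>tensor_algebra K A R\<^esub> Y = X <#>\<^bsub>tensor_free A R\<^esub> Y"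
  "X \<otimes>\<^bsub>tensor_algebra K A R\<^esub> Y = (\<Union>x\<in>X. \<Union>y\<in>Y. tensor_class K A R (formal_mult A R x y))"
  "t \<odot>\<^bsub>tensor_algebra K A R\<^esub> X = (\<Union>x\<in>X. tensor_class K A R (map_coeffs ((\<otimes>\<^bsub>R\<^esub>) t) x))"
  by (simp_all add: tensor_algebra_def FactGroup_def map_coeffs_def)

text \<open>
  The operations on cosets are unions of classes over all representatives.  Once such a union is known to
  be a single coset, it equals the class computed from any one choice of representatives.
\<close>

lemma tensor_class_eq_if_subset:
  assumes "nonassoc_algebra K A" "algebra K R"
    and "C \<in> carrier (tensor_algebra K A R)" "tensor_class K A R x \<subseteq> C"
    and "Poly_Mapping.keys x \<subseteq> carrier A \<times> carrier R"
  shows "tensor_class K A R x = C"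
proof -
  interpret tensor_ker: normal "tensor_ker K A R" "tensor_free A R"
    by (rule tensor_ker_normal[OF assms(1,2)])
  show ?thesis
    using rcoset_eq_of_subset[OF tensor_ker.is_group tensor_ker.subgroup_axioms, of C x] assms(3-)
    by (simp add: tensor_algebra_simps)
qed

lemma tensor_class_self:
  assumes "nonassoc_algebra K A" "algebra K R"
    and "Poly_Mapping.keys x \<subseteq> carrier A \<times> carrier R"
  shows "x \<in> tensor_class K A R x"
proof -
  interpret tensor_ker: normal "tensor_ker K A R" "tensor_free A R"
    by (rule tensor_ker_normal[OF assms(1,2)])
  show ?thesis
    using tensor_ker.rcos_self[OF _ tensor_ker.subgroup_axioms, of x] assms(3) by simp
qed

text \<open>
  The presentation is the quotient map onto cosets followed by the inverse of \<open>\<tau>\<close>.  Independence of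
  representatives comes for free: for example \<open>\<tau> (\<pi> x \<otimes> \<pi> y)\<close> is a coset because \<open>\<tau>\<close> maps into
  the carrier, and it is the union of the classes of all products of representatives because \<open>\<tau>\<close> is
  multiplicative; so it contains, hence equals, the class of the formal product of \<open>x\<close> and \<open>y\<close>.  The
  last claim packages this argument.
\<close>

lemma scalar_extension_of_iso:
  assumes A: "nonassoc_algebra K A" and R: "algebra K R" and M: "nonassoc_algebra R M"
    and \<tau>: "\<tau> \<in> nonassoc_iso R M (tensor_algebra K A R)"
    and \<pi>_def: "\<pi> = (\<lambda>x. inv_into (carrier M) \<tau> (tensor_class K A R x))"
  shows "scalar_extension K A R M \<pi>"
    and "Poly_Mapping.keys x \<subseteq> carrier A \<times> carrier R \<Longrightarrow> \<tau> (\<pi> x) = tensor_class K A R x"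
    and "\<lbrakk>Poly_Mapping.keys x \<subseteq> carrier A \<times> carrier R; m \<in> carrier M;
          tensor_class K A R x \<subseteq> \<tau> m\<rbrakk> \<Longrightarrow> \<pi> x = m"
proof -
  interpret A: nonassoc_algebra K A by fact
  interpret R: algebra K R by fact
  interpret M: nonassoc_algebra R M by fact
  interpret N: normal "tensor_ker K A R" "tensor_free A R"
    by (rule tensor_ker_normal[OF A R])
  have hom: "\<tau> \<in> nonassoc_hom R M (tensor_algebra K A R)"
    and bij: "bij_betw \<tau> (carrier M) (carrier (tensor_algebra K A R))"
    using \<tau> by (auto simp: nonassoc_iso_def)
  have class_closed: "tensor_class K A R x \<in> carrier (tensor_algebra K A R)"
    if "Poly_Mapping.keys x \<subseteq> carrier A \<times> carrier R" for x
    using that N.rcosetsI[OF N.subset] by (simp add: tensor_algebra_simps)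
  show \<tau>\<pi>: "\<tau> (\<pi> x) = tensor_class K A R x" if "Poly_Mapping.keys x \<subseteq> carrier A \<times> carrier R" for x
    unfolding \<pi>_def using bij class_closed[OF that] by (auto simp: bij_betw_def f_inv_into_f)
  have closed: "\<pi> x \<in> carrier M" if "Poly_Mapping.keys x \<subseteq> carrier A \<times> carrier R" for x
    unfolding \<pi>_def using bij class_closed[OF that] by (auto simp: bij_betw_def inv_into_into)
  show eqI: "\<pi> x = m"
    if "Poly_Mapping.keys x \<subseteq> carrier A \<times> carrier R" "m \<in> carrier M" "tensor_class K A R x \<subseteq> \<tau> m"
    for x m
  proof -
    have "tensor_class K A R x = \<tau> m"
      using tensor_class_eq_if_subset[OF A R nonassoc_homD(2)[OF hom that(2)] that(3,1)] .
    then show ?thesis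
      unfolding \<pi>_def using bij that(2) by (simp add: bij_betw_def inv_into_f_f)
  qed
  have \<pi>_add: "\<pi> (x + y) = \<pi> x \<oplus>\<^bsub>M\<^esub> \<pi> y"
    if "Poly_Mapping.keys x \<subseteq> carrier A \<times> carrier R" "Poly_Mapping.keys y \<subseteq> carrier A \<times> carrier R" for x y
  proof (rule eqI)
    show "tensor_class K A R (x + y) \<subseteq> \<tau> (\<pi> x \<oplus>\<^bsub>M\<^esub> \<pi> y)"
      using that N.rcos_sum[of x y]
      by (simp add: nonassoc_homD(3)[OF hom] closed \<tau>\<pi> tensor_algebra_simps)
  qed (use that in \<open>simp_all add: closed keys_subset_add\<close>)
  have \<pi>_zero: "\<pi> 0 = \<zero>\<^bsub>M\<^esub>"
    using \<pi>_add[of 0 0] closed[of 0] by (simp add: M.add.l_cancel_one)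
  have zero_ker: "0 \<in> tensor_ker K A R"
    using subgroup.one_closed[OF N.subgroup_axioms] by simp
  have ker_class: "x \<in> tensor_ker K A R \<longleftrightarrow> tensor_class K A R x = tensor_class K A R 0"
    if "Poly_Mapping.keys x \<subseteq> carrier A \<times> carrier R" for x
    using that N.coset_join1[of "tensor_ker K A R" x] N.coset_join2[of x "tensor_ker K A R"]
      N.coset_join2[of 0 "tensor_ker K A R"] zero_ker N.subset N.subgroup_axioms
    by (auto simp del: mem_tensor_free simp: mem_tensor_free[symmetric])
  show "scalar_extension K A R M \<pi>"
  proof (intro scalar_extension.intro scalar_extension_axioms.intro A R M)
    show "\<pi> \<in> hom (tensor_free A R) (add_monoid M)"
      by (rule homI) (use closed \<pi>_add in auto)
    show "\<pi> ` carrier (tensor_free A R) = carrier M"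
    proof (intro equalityI subsetI)
      fix m assume m: "m \<in> carrier M"
      obtain x where x: "x \<in> carrier (tensor_free A R)" "\<tau> m = tensor_class K A R x"
        using nonassoc_homD(2)[OF hom m] by (auto simp: tensor_algebra_simps RCOSETS_def)
      then have "\<pi> x = m"
        using m by (intro eqI) auto
      then show "m \<in> \<pi> ` carrier (tensor_free A R)"
        using x by blast
    qed (use closed in auto)
  next
    fix x assume x: "x \<in> carrier (tensor_free A R)"
    have "\<pi> x = \<pi> 0 \<longleftrightarrow> tensor_class K A R x = tensor_class K A R 0"
    proof
      assume "\<pi> x = \<pi> 0"
      then have "\<tau> (\<pi> x) = \<tau> (\<pi> 0)" by simp
      then show "tensor_class K A R x = tensor_class K A R 0"
        using x \<tau>\<pi>[of x] \<tau>\<pi>[of 0] by simp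
    qed (simp add: \<pi>_def)
    then show "\<pi> x = \<zero>\<^bsub>M\<^esub> \<longleftrightarrow> x \<in> tensor_ker K A R"
      using x by (simp add: \<pi>_zero ker_class)
  next
    fix x y assume xy: "x \<in> carrier (tensor_free A R)" "y \<in> carrier (tensor_free A R)"
    show "\<pi> (formal_mult A R x y) = \<pi> x \<otimes>\<^bsub>M\<^esub> \<pi> y"
    proof (rule eqI)
      show "tensor_class K A R (formal_mult A R x y) \<subseteq> \<tau> (\<pi> x \<otimes>\<^bsub>M\<^esub> \<pi> y)"
      proof -
        have "\<tau> (\<pi> x \<otimes>\<^bsub>M\<^esub> \<pi> y) =
            (\<Union>x'\<in>tensor_class K A R x. \<Union>y'\<in>tensor_class K A R y. tensor_class K A R (formal_mult A R x' y'))"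
          using xy by (simp add: nonassoc_homD(4)[OF hom] closed \<tau>\<pi> tensor_algebra_simps(3))
        then show ?thesis
          using xy tensor_class_self[OF A R, of x] tensor_class_self[OF A R, of y] by auto
      qed
      show "Poly_Mapping.keys (formal_mult A R x y) \<subseteq> carrier A \<times> carrier R"
        using xy by (simp add: keys_formal_mult[OF A R])
    qed (use xy in \<open>simp add: M.mult_closed closed\<close>)
  next
    fix t x assume t: "t \<in> carrier R" and x: "x \<in> carrier (tensor_free A R)"
    show "\<pi> (map_coeffs ((\<otimes>\<^bsub>R\<^esub>) t) x) = t \<odot>\<^bsub>M\<^esub> \<pi> x"
    proof (rule eqI)
      show "tensor_class K A R (map_coeffs ((\<otimes>\<^bsub>R\<^esub>) t) x) \<subseteq> \<tau> (t \<odot>\<^bsub>M\<^esub> \<pi> x)"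
      proof -
        have "\<tau> (t \<odot>\<^bsub>M\<^esub> \<pi> x) = (\<Union>x'\<in>tensor_class K A R x. tensor_class K A R (map_coeffs ((\<otimes>\<^bsub>R\<^esub>) t) x'))"
          using t x by (simp add: nonassoc_homD(5)[OF hom] closed \<tau>\<pi> tensor_algebra_simps(4))
        then show ?thesis
          using x tensor_class_self[OF A R, of x] by auto
      qed
      show "Poly_Mapping.keys (map_coeffs ((\<otimes>\<^bsub>R\<^esub>) t) x) \<subseteq> carrier A \<times> carrier R"
        using t x by (intro keys_map_coeffs) auto
    qed (use t x in \<open>simp add: closed\<close>)
  qed
qed

section \<open>Extension invariant functors\<close>

lemma algebra_if_alg_obj:
  assumes "alg_obj K R"
  shows "algebra K R"
  using assms by (simp add: alg_obj_def)

lemma alg_homD: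
  assumes "\<phi> \<in> alg_hom K R S"
  shows "r \<in> carrier R \<Longrightarrow> \<phi> r \<in> carrier S"
    and "\<lbrakk>r \<in> carrier R; s \<in> carrier R\<rbrakk> \<Longrightarrow> \<phi> (r \<otimes>\<^bsub>R\<^esub> s) = \<phi> r \<otimes>\<^bsub>S\<^esub> \<phi> s"
    and "\<phi> \<one>\<^bsub>R\<^esub> = \<one>\<^bsub>S\<^esub>"
  using assms by (auto simp: alg_hom_def ring_hom_def Pi_iff)

lemma self_algebra_simps [simp]:
  "carrier (self_algebra K) = carrier K" "x \<otimes>\<^bsub>self_algebra K\<^esub> y = x \<otimes>\<^bsub>K\<^esub> y"
  "x \<oplus>\<^bsub>self_algebra K\<^esub> y = x \<oplus>\<^bsub>K\<^esub> y" "\<one>\<^bsub>self_algebra K\<^esub> = \<one>\<^bsub>K\<^esub>" "\<zero>\<^bsub>self_algebra K\<^esub> = \<zero>\<^bsub>K\<^esub>"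
  "k \<odot>\<^bsub>self_algebra K\<^esub> x = k \<otimes>\<^bsub>K\<^esub> x"
  by (simp_all add: self_algebra_def)

lemma cring_self_algebra:
  assumes "cring K"
  shows "cring (self_algebra K)"
proof -
  interpret cring K by fact
  have "\<exists>y\<in>carrier K. y \<oplus>\<^bsub>K\<^esub> x = \<zero>\<^bsub>K\<^esub>" if "x \<in> carrier K" for x
    using that by (intro bexI[of _ "\<ominus>\<^bsub>K\<^esub> x"]) (simp_all add: l_neg)
  moreover have "comm_monoid (self_algebra K)"
    by (rule comm_monoidI) (simp_all add: m_assoc m_lcomm m_comm)
  ultimately show ?thesis
    by (intro cringI abelian_groupI) (simp_all add: a_assoc a_comm a_lcomm l_distr)
qed

lemma alg_obj_self_algebra:
  assumes "cring K" "\<one>\<^bsub>K\<^esub> \<noteq> \<zero>\<^bsub>K\<^esub>"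
  shows "alg_obj K (self_algebra K)"
proof -
  interpret cring K by fact
  show ?thesis
    unfolding alg_obj_def
    using assms by (auto intro!: algebraI cring_self_algebra simp: l_distr r_distr m_assoc)
qed

lemma nonassoc_algebra_self_algebra:
  assumes "cring K" "nonassoc_algebra (self_algebra K) A"
  shows "nonassoc_algebra K A"
proof -
  interpret nonassoc_algebra "self_algebra K" A by fact
  show ?thesis
    using assms(1) nonassoc_algebra_axioms M.abelian_group_axioms
    by (simp add: nonassoc_algebra_def module_def module_axioms_def nonassoc_algebra_axioms_def)
qed

lemma structure_map_alg_hom:
  assumes "alg_obj K S"
  shows "(\<lambda>k\<in>carrier K. k \<odot>\<^bsub>S\<^esub> \<one>\<^bsub>S\<^esub>) \<in> alg_hom K (self_algebra K) S"
proof -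
  interpret S: algebra K S using assms by (rule algebra_if_alg_obj)
  show ?thesis
    by (auto simp: alg_hom_def ring_hom_def S.smult_l_distr S.smult_assoc1 S.smult_assoc2)
qed

text \<open>
  Homomorphisms see the base ring only through its carrier and the action on the algebras.
\<close>

lemma nonassoc_isomorphic_self_algebra:
  "nonassoc_isomorphic (self_algebra K) A B \<longleftrightarrow> nonassoc_isomorphic K A B"
  by (simp add: nonassoc_isomorphic_def nonassoc_iso_def nonassoc_hom_def)


lemma nonassoc_hom_restrict_scalars:
  assumes "algebra K R" "f \<in> nonassoc_hom R M N"
  shows "f \<in> nonassoc_hom K (restrict_scalars R M) (restrict_scalars R N)"
proof -
  interpret algebra K R by fact
  show ?thesis
    using assms(2) by (auto simp: nonassoc_hom_def restrict_scalars_def)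
qed

lemma nonassoc_hom_compose:
  assumes "nonassoc_algebra K A" "f \<in> nonassoc_hom K A B" "g \<in> nonassoc_hom K B C"
  shows "compose (carrier A) g f \<in> nonassoc_hom K A C"
  unfolding compose_def
  by (rule restrict_in_nonassoc_hom[OF assms(1)])
    (simp_all add: nonassoc_homD[OF assms(2)] nonassoc_homD[OF assms(3)])

text \<open>
  What extension invariance says in terms of presentations: the values are scalar extensions of
  \<open>F(K)\<close>, and under this identification \<open>F(\<phi>)\<close> is \<open>1 \<otimes> \<phi>\<close>.
\<close>

locale presented_functor = algebra_functor K Fo Fm
  for K :: "'r ring" and Fo :: "('r, 'r) module \<Rightarrow> ('r, 'a) module"
    and Fm :: "('r, 'r) module \<Rightarrow> ('r, 'r) module \<Rightarrow> ('r \<Rightarrow> 'r) \<Rightarrow> 'a \<Rightarrow> 'a" +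
  fixes \<pi> :: "('r, 'r) module \<Rightarrow> ('a \<times> 'r \<Rightarrow>\<^sub>0 int) \<Rightarrow> 'a"
  assumes presentation:
      "alg_obj K R \<Longrightarrow> scalar_extension K (Fo (self_algebra K)) R (Fo R) (\<pi> R)"
    and presentation_natural:
      "\<lbrakk>alg_obj K R; alg_obj K S; \<phi> \<in> alg_hom K R S;
        x \<in> carrier (tensor_free (Fo (self_algebra K)) R)\<rbrakk> \<Longrightarrow>
       Fm R S \<phi> (\<pi> R x) = \<pi> S (map_coeffs \<phi> x)"
begin

abbreviation unit_at :: "('r, 'r) module \<Rightarrow> 'a \<Rightarrow> 'a" where
  "unit_at R \<equiv> scalar_extension.unit_map (Fo (self_algebra K)) R (\<pi> R)"

lemma arr_unit:
  assumes R: "alg_obj K R" and S: "alg_obj K S" and \<phi>: "\<phi> \<in> alg_hom K R S"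
    and a: "a \<in> carrier (Fo (self_algebra K))"
  shows "Fm R S \<phi> (unit_at R a) = unit_at S a"
proof -
  interpret P: scalar_extension K "Fo (self_algebra K)" R "Fo R" "\<pi> R" by (rule presentation[OF R])
  interpret Q: scalar_extension K "Fo (self_algebra K)" S "Fo S" "\<pi> S" by (rule presentation[OF S])
  show ?thesis
    using presentation_natural[OF R S \<phi>, of "frag_of (a, \<one>\<^bsub>R\<^esub>)"] a
    by (simp add: P.unit_map_apply Q.unit_map_apply alg_homD(3)[OF \<phi>])
qed

text \<open>
  A functor is only required to give \<open>K\<close>-linear arrows.  Here \<open>F(\<phi>)\<close> is \<open>1 \<otimes> \<phi>\<close>, and
  \<open>a \<otimes> \<phi>(r s) = \<phi>(r) (a \<otimes> \<phi>(s))\<close>.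
\<close>

lemma arr_semilinear:
  assumes R: "alg_obj K R" and S: "alg_obj K S" and \<phi>: "\<phi> \<in> alg_hom K R S"
  shows "Fm R S \<phi> \<in> semilinear_maps R \<phi> (Fo R) (Fo S)"
proof -
  interpret P: scalar_extension K "Fo (self_algebra K)" R "Fo R" "\<pi> R" by (rule presentation[OF R])
  interpret Q: scalar_extension K "Fo (self_algebra K)" S "Fo S" "\<pi> S" by (rule presentation[OF S])
  have "Fm R S \<phi> (r \<odot>\<^bsub>Fo R\<^esub> m) = \<phi> r \<odot>\<^bsub>Fo S\<^esub> Fm R S \<phi> m"
    if r: "r \<in> carrier R" and m: "m \<in> carrier (Fo R)" for r m
  proof -
    obtain x where x: "Poly_Mapping.keys x \<subseteq> carrier (Fo (self_algebra K)) \<times> carrier R" "m = \<pi> R x"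
      using P.proj_cases[OF m] by blast
    have keys: "Poly_Mapping.keys (map_coeffs ((\<otimes>\<^bsub>R\<^esub>) r) x) \<subseteq> carrier (Fo (self_algebra K)) \<times> carrier R"
      "Poly_Mapping.keys (map_coeffs \<phi> x) \<subseteq> carrier (Fo (self_algebra K)) \<times> carrier S"
      by (rule keys_map_coeffs[OF x(1)], use r alg_homD(1)[OF \<phi>] in simp)+
    have "Fm R S \<phi> (r \<odot>\<^bsub>Fo R\<^esub> m) = Fm R S \<phi> (\<pi> R (map_coeffs ((\<otimes>\<^bsub>R\<^esub>) r) x))"
      using r x by (simp add: P.proj_smult)
    also have "\<dots> = \<pi> S (map_coeffs \<phi> (map_coeffs ((\<otimes>\<^bsub>R\<^esub>) r) x))"
      using keys(1) by (simp add: presentation_natural[OF R S \<phi>])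
    also have "map_coeffs \<phi> (map_coeffs ((\<otimes>\<^bsub>R\<^esub>) r) x) = map_coeffs ((\<otimes>\<^bsub>S\<^esub>) (\<phi> r)) (map_coeffs \<phi> x)"
      by (rule map_coeffs_commute[OF x(1)]) (rule alg_homD(2)[OF \<phi> r])
    also have "\<pi> S \<dots> = \<phi> r \<odot>\<^bsub>Fo S\<^esub> \<pi> S (map_coeffs \<phi> x)"
      using keys(2) alg_homD(1)[OF \<phi> r] by (simp add: Q.proj_smult)
    also have "\<pi> S (map_coeffs \<phi> x) = Fm R S \<phi> m"
      using x by (simp add: presentation_natural[OF R S \<phi>])
    finally show ?thesis .
  qed
  then show ?thesis
    using nonassoc_homD(2,3)[OF arr[OF R S \<phi>]] by (simp add: semilinear_maps_def restrict_scalars_def)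
qed

text \<open>
  The image of \<open>F(\<phi>)\<close> contains every \<open>a \<otimes> 1\<close> and therefore generates \<open>F(S)\<close> over \<open>S\<close>.
\<close>

lemma hom_eq_if_agree_on_arr:
  assumes R: "alg_obj K R" and S: "alg_obj K S" and \<phi>: "\<phi> \<in> alg_hom K R S"
    and N: "abelian_group N"
    and u: "u \<in> semilinear_maps S id (Fo S) N" and v: "v \<in> semilinear_maps S id (Fo S) N"
    and eq: "\<And>x. x \<in> carrier (Fo R) \<Longrightarrow> u (Fm R S \<phi> x) = v (Fm R S \<phi> x)"
    and m: "m \<in> carrier (Fo S)"
  shows "u m = v m"
proof -
  interpret P: scalar_extension K "Fo (self_algebra K)" R "Fo R" "\<pi> R" by (rule presentation[OF R])
  interpret Q: scalar_extension K "Fo (self_algebra K)" S "Fo S" "\<pi> S" by (rule presentation[OF S])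
  show ?thesis
  proof (rule Q.semilinear_eqI[OF N u v _ m])
    fix a assume a: "a \<in> carrier (Fo (self_algebra K))"
    then have "P.unit_map a \<in> carrier (Fo R)"
      by (simp add: P.unit_map_apply P.tensor_closed)
    then show "u (Q.unit_map a) = v (Q.unit_map a)"
      using eq arr_unit[OF R S \<phi> a] by metis
  qed
qed

end

text \<open>
  The lift of \<open>a \<mapsto> G(\<phi>)(\<theta>(a \<otimes> 1))\<close>.  The square with \<open>F(\<phi>)\<close> and \<open>G(\<phi>)\<close> then commutes on the
  elements \<open>a \<otimes> 1\<close>; its two sides are linear along \<open>\<phi>\<close>, so it commutes on all of \<open>F(R)\<close>.
\<close>

lemma hom_change_of_scalars:
  assumes F: "presented_functor K Fo Fm \<pi>" and G: "presented_functor K Go Gm \<rho>"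
    and R: "alg_obj K R" and S: "alg_obj K S" and \<phi>: "\<phi> \<in> alg_hom K R S"
    and \<theta>: "\<theta> \<in> nonassoc_hom R (Fo R) (Go R)"
  obtains h where "h \<in> nonassoc_hom S (Fo S) (Go S)"
    "\<And>x. x \<in> carrier (Fo R) \<Longrightarrow> h (Fm R S \<phi> x) = Gm R S \<phi> (\<theta> x)"
proof -
  interpret F: presented_functor K Fo Fm \<pi> by fact
  interpret G: presented_functor K Go Gm \<rho> by fact
  let ?A = "Fo (self_algebra K)"
  interpret P: scalar_extension K ?A R "Fo R" "\<pi> R" by (rule F.presentation[OF R])
  interpret Q: scalar_extension K ?A S "Fo S" "\<pi> S" by (rule F.presentation[OF S])
  interpret GS: nonassoc_algebra S "Go S" by (rule G.obj[OF S])
  let ?f = "compose (carrier ?A) (Gm R S \<phi>) (compose (carrier ?A) \<theta> P.unit_map)"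
  have "?f \<in> nonassoc_hom K ?A (restrict_scalars S (Go S))"
    by (rule nonassoc_hom_compose[OF P.base.nonassoc_algebra_axioms
          nonassoc_hom_compose[OF P.base.nonassoc_algebra_axioms P.unit_map_hom
            nonassoc_hom_restrict_scalars[OF P.scalars.algebra_axioms \<theta>]] G.arr[OF R S \<phi>]])
  then obtain h where h: "h \<in> nonassoc_hom S (Fo S) (Go S)"
    and h_unit: "\<And>a. a \<in> carrier ?A \<Longrightarrow> h (Q.unit_map a) = ?f a"
    using Q.nonassoc_hom_lift[OF GS.nonassoc_algebra_axioms] by blast
  have "(h \<circ> Fm R S \<phi>) x = (Gm R S \<phi> \<circ> \<theta>) x" if x: "x \<in> carrier (Fo R)" for x
  proof (rule P.semilinear_eqI[OF GS.abelian_group_axioms _ _ _ x])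
    show "h \<circ> Fm R S \<phi> \<in> semilinear_maps R \<phi> (Fo R) (Go S)"
      using semilinear_comp[OF F.arr_semilinear[OF R S \<phi>] nonassoc_hom_semilinear[OF h]]
        alg_homD(1)[OF \<phi>] by simp
    show "Gm R S \<phi> \<circ> \<theta> \<in> semilinear_maps R \<phi> (Fo R) (Go S)"
      using semilinear_comp[OF nonassoc_hom_semilinear[OF \<theta>] G.arr_semilinear[OF R S \<phi>]] by simp
    show "(h \<circ> Fm R S \<phi>) (P.unit_map a) = (Gm R S \<phi> \<circ> \<theta>) (P.unit_map a)" if "a \<in> carrier ?A" for a
      using that by (simp add: F.arr_unit[OF R S \<phi>] h_unit compose_eq)
  qed
  with h show thesis
    by (intro that) auto
qed

text \<open>
  The homomorphisms induced by \<open>\<theta>\<close> and by its inverse are mutually inverse: their composites fix the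
  images of \<open>F(\<phi>)\<close> and \<open>G(\<phi>)\<close>.
\<close>

lemma isomorphic_change_of_scalars:
  assumes F: "presented_functor K Fo Fm \<pi>" and G: "presented_functor K Go Gm \<rho>"
    and R: "alg_obj K R" and S: "alg_obj K S" and \<phi>: "\<phi> \<in> alg_hom K R S"
    and iso: "nonassoc_isomorphic R (Fo R) (Go R)"
  shows "nonassoc_isomorphic S (Fo S) (Go S)"
proof -
  interpret F: presented_functor K Fo Fm \<pi> by fact
  interpret G: presented_functor K Go Gm \<rho> by fact
  interpret FS: nonassoc_algebra S "Fo S" by (rule F.obj[OF S])
  interpret GS: nonassoc_algebra S "Go S" by (rule G.obj[OF S])
  obtain \<theta> where \<theta>: "\<theta> \<in> nonassoc_iso R (Fo R) (Go R)"
    using iso by (auto simp: nonassoc_isomorphic_def)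
  then have \<theta>_hom: "\<theta> \<in> nonassoc_hom R (Fo R) (Go R)" and bij: "bij_betw \<theta> (carrier (Fo R)) (carrier (Go R))"
    by (auto simp: nonassoc_iso_def)
  define \<theta>' where "\<theta>' = restrict (inv_into (carrier (Fo R)) \<theta>) (carrier (Go R))"
  have \<theta>'_hom: "\<theta>' \<in> nonassoc_hom R (Go R) (Fo R)"
    unfolding \<theta>'_def by (rule nonassoc_iso_inverse[OF F.obj[OF R] G.obj[OF R] \<theta>])
  have inv1: "\<theta>' (\<theta> x) = x" if "x \<in> carrier (Fo R)" for x
    using that bij nonassoc_homD(2)[OF \<theta>_hom that] by (simp add: \<theta>'_def bij_betw_def inv_into_f_f)
  have inv2: "\<theta> (\<theta>' y) = y" if "y \<in> carrier (Go R)" for y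
    using that bij by (simp add: \<theta>'_def bij_betw_def f_inv_into_f)
  obtain h where h: "h \<in> nonassoc_hom S (Fo S) (Go S)"
    and h_arr: "\<And>x. x \<in> carrier (Fo R) \<Longrightarrow> h (Fm R S \<phi> x) = Gm R S \<phi> (\<theta> x)"
    using hom_change_of_scalars[OF F G R S \<phi> \<theta>_hom] by blast
  obtain h' where h': "h' \<in> nonassoc_hom S (Go S) (Fo S)"
    and h'_arr: "\<And>y. y \<in> carrier (Go R) \<Longrightarrow> h' (Gm R S \<phi> y) = Fm R S \<phi> (\<theta>' y)"
    using hom_change_of_scalars[OF G F R S \<phi> \<theta>'_hom] by blast
  have id: "id \<in> semilinear_maps S id M M" for M
    by (simp add: semilinear_maps_def)
  have h'h: "h' (h m) = m" if m: "m \<in> carrier (Fo S)" for m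
  proof -
    have "(h' \<circ> h) m = id m"
    proof (rule F.hom_eq_if_agree_on_arr[OF R S \<phi> FS.abelian_group_axioms _ id _ m])
      show "h' \<circ> h \<in> semilinear_maps S id (Fo S) (Fo S)"
        using semilinear_comp[OF nonassoc_hom_semilinear[OF h] nonassoc_hom_semilinear[OF h']]
        by simp
    qed (simp add: h_arr h'_arr nonassoc_homD(2)[OF \<theta>_hom] inv1)
    then show ?thesis by simp
  qed
  have hh': "h (h' m) = m" if m: "m \<in> carrier (Go S)" for m
  proof -
    have "(h \<circ> h') m = id m"
    proof (rule G.hom_eq_if_agree_on_arr[OF R S \<phi> GS.abelian_group_axioms _ id _ m])
      show "h \<circ> h' \<in> semilinear_maps S id (Go S) (Go S)"
        using semilinear_comp[OF nonassoc_hom_semilinear[OF h'] nonassoc_hom_semilinear[OF h]]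
        by simp
    qed (simp add: h_arr h'_arr nonassoc_homD(2)[OF \<theta>'_hom] inv2)
    then show ?thesis by simp
  qed
  have "bij_betw h (carrier (Fo S)) (carrier (Go S))"
    by (rule bij_betw_byWitness[where f' = h'])
      (use h'h hh' nonassoc_homD(2)[OF h] nonassoc_homD(2)[OF h'] in auto)
  then show ?thesis
    using h by (auto simp: nonassoc_isomorphic_def nonassoc_iso_def)
qed

text \<open>
  Naturality of the presentation again reads off one representative: \<open>1 \<otimes> \<phi>\<close> of a coset is defined as a
  union, which naturality of \<open>\<tau>\<close> identifies with the coset \<open>\<tau> (F(\<phi>)(\<pi> x))\<close>.
\<close>

lemma extension_invariant_presented:
  assumes K: "cring K" "\<one>\<^bsub>K\<^esub> \<noteq> \<zero>\<^bsub>K\<^esub>"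
    and F: "algebra_functor K Fo Fm" and inv: "extension_invariant K Fo Fm"
  obtains \<pi> where "presented_functor K Fo Fm \<pi>"
proof -
  interpret algebra_functor K Fo Fm by fact
  let ?A = "Fo (self_algebra K)"
  have A: "nonassoc_algebra K ?A"
    using nonassoc_algebra_self_algebra[OF K(1) obj[OF alg_obj_self_algebra[OF K]]] .
  obtain \<tau> where \<tau>: "\<And>R. alg_obj K R \<Longrightarrow> \<tau> R \<in> nonassoc_iso R (Fo R) (tensor_algebra K ?A R)"
    and natural: "\<And>R S \<phi> x. \<lbrakk>\<phi> \<in> alg_hom K R S; alg_obj K R; alg_obj K S; x \<in> carrier (Fo R)\<rbrakk> \<Longrightarrow>
      tensor_map K ?A S \<phi> (\<tau> R x) = \<tau> S (Fm R S \<phi> x)"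
    using inv unfolding extension_invariant_def by metis
  define \<pi> where "\<pi> R x = inv_into (carrier (Fo R)) (\<tau> R) (tensor_class K ?A R x)" for R x
  have \<pi>: "\<pi> R = (\<lambda>x. inv_into (carrier (Fo R)) (\<tau> R) (tensor_class K ?A R x))" for R
    by (simp add: \<pi>_def fun_eq_iff)
  note ext = scalar_extension_of_iso[OF A algebra_if_alg_obj obj \<tau> \<pi>]
  show thesis
  proof (rule that, intro presented_functor.intro presented_functor_axioms.intro F)
    fix R S \<phi> x
    assume R: "alg_obj K R" and S: "alg_obj K S" and \<phi>: "\<phi> \<in> alg_hom K R S"
      and "x \<in> carrier (tensor_free ?A R)"
    then have x: "Poly_Mapping.keys x \<subseteq> carrier ?A \<times> carrier R" by simp
    interpret P: scalar_extension K ?A R "Fo R" "\<pi> R" by (rule ext(1)[OF R R R])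
    have m: "\<pi> R x \<in> carrier (Fo R)" 
      using x P.proj_closed by simp
    have "\<pi> S (map_coeffs \<phi> x) = Fm R S \<phi> (\<pi> R x)"
    proof (rule ext(3)[OF S S S])
      show "Poly_Mapping.keys (map_coeffs \<phi> x) \<subseteq> carrier ?A \<times> carrier S"
        using x alg_homD(1)[OF \<phi>] by (rule keys_map_coeffs)
      show "Fm R S \<phi> (\<pi> R x) \<in> carrier (Fo S)"
        using nonassoc_homD(2)[OF arr[OF R S \<phi>], of "\<pi> R x"] m by (simp add: restrict_scalars_def)
      have "tensor_class K ?A S (map_coeffs \<phi> x) \<subseteq> tensor_map K ?A S \<phi> (\<tau> R (\<pi> R x))"
        using tensor_class_self[OF A algebra_if_alg_obj[OF R] x]
        by (auto simp: tensor_map_def ext(2)[OF R R R x] map_coeffs_def)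
      then show "tensor_class K ?A S (map_coeffs \<phi> x) \<subseteq> \<tau> S (Fm R S \<phi> (\<pi> R x))"
        by (simp add: natural[OF \<phi> R S m])
    qed
    then show "Fm R S \<phi> (\<pi> R x) = \<pi> S (map_coeffs \<phi> x)" by simp
  qed (rule ext(1))
qed

theorem corollary2p5:
  fixes K :: "'r ring"
    and Fo :: "('r, 'r) module \<Rightarrow> ('r, 'a) module"
    and Fm :: "('r, 'r) module \<Rightarrow> ('r, 'r) module \<Rightarrow> ('r \<Rightarrow> 'r) \<Rightarrow> 'a \<Rightarrow> 'a"
    and Go :: "('r, 'r) module \<Rightarrow> ('r, 'b) module"
    and Gm :: "('r, 'r) module \<Rightarrow> ('r, 'r) module \<Rightarrow> ('r \<Rightarrow> 'r) \<Rightarrow> 'b \<Rightarrow> 'b"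
  assumes "cring K" and "\<one>\<^bsub>K\<^esub> \<noteq> \<zero>\<^bsub>K\<^esub>"
    and "algebra_functor K Fo Fm" and "extension_invariant K Fo Fm"
    and "algebra_functor K Go Gm" and "extension_invariant K Go Gm"
  shows "(\<forall>R S. \<forall>\<phi>\<in>alg_hom K R S. alg_obj K R \<longrightarrow> alg_obj K S \<longrightarrow>
            nonassoc_isomorphic R (Fo R) (Go R) \<longrightarrow> nonassoc_isomorphic S (Fo S) (Go S))
       \<and> (\<forall>R. \<forall>\<psi>\<in>alg_hom K R (self_algebra K). alg_obj K R \<longrightarrow>
            nonassoc_isomorphic R (Fo R) (Go R) \<longrightarrow>
              nonassoc_isomorphic K (Fo (self_algebra K)) (Go (self_algebra K)) \<and>
              (\<forall>S. alg_obj K S \<longrightarrow> nonassoc_isomorphic S (Fo S) (Go S)))"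
proof -
  obtain \<pi> where F: "presented_functor K Fo Fm \<pi>"
    using extension_invariant_presented[OF assms(1-4)] .
  obtain \<rho> where G: "presented_functor K Go Gm \<rho>"
    using extension_invariant_presented[OF assms(1,2,5,6)] .
  note change = isomorphic_change_of_scalars[OF F G]
  note K_obj = alg_obj_self_algebra[OF assms(1,2)]
  show ?thesis
  proof (intro conjI allI ballI impI)
    fix R \<psi>
    assume \<psi>: "\<psi> \<in> alg_hom K R (self_algebra K)" and R: "alg_obj K R"
      and iso: "nonassoc_isomorphic R (Fo R) (Go R)"
    have *: "nonassoc_isomorphic (self_algebra K) (Fo (self_algebra K)) (Go (self_algebra K))"
      by (rule change[OF R K_obj \<psi> iso])
    then show "nonassoc_isomorphic K (Fo (self_algebra K)) (Go (self_algebra K))"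
      by (simp add: nonassoc_isomorphic_self_algebra)
    show "nonassoc_isomorphic S (Fo S) (Go S)" if S: "alg_obj K S" for S
      by (rule change[OF K_obj S structure_map_alg_hom[OF S] *])
  qed (rule change)
qed

end
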